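(* Let $A$ and $B$ be strictly positive operators on a Hilbert space $H$ such that $uA \le B \le vA$ for real numbers $u,v>0$, and let $-1\le p\le 1$ with $p\neq 0$. If $u\ge 1$, then $$S_{p/2}(A|B)\ \le\ T_p(A|B)\ \le\ \frac{S(A|B)+S_p(A|B)}{2}.$$ If $v\le 1$, then the reverse inequalities hold, i.e. $$S_{p/2}(A|B)\ \ge\ T_p(A|B)\ \ge\ \frac{S(A|B)+S_p(A|B)}{2}.$$
   Context: An operator $A\in B(H)$ (bounded linear operators on a Hilbert space $H$) is strictly positive, $A>0$, if $A\ge 0$ and $A$ is invertible. For self-adjoint $X,Y$, $X\le Y$ means $Y-X$ is positive semidefinite. Powers and logarithms are taken by functional calculus. For $A,B>0$: - Relative operator entropy: $S(A|B)=A^{1/2}\log(A^{-1/2}BA^{-1/2})A^{1/2}$. - Generalized relative operator entropy, $r\in\mathbb{R}$: $S_r(A|B)=A^{1/2}(A^{-1/2}BA^{-1/2})^r\log(A^{-1/2}BA^{-1/2})A^{1/2}$. - Tsallis relative operator entropy, $p\in[-1,1]$, $p\ne0$: $T_p(A|B)=\dfrac{A^{1/2}(A^{-1/2}BA^{-1/2})^pA^{1/2}-A}{p}$. *)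

theory Defs
  imports "HOL-Analysis.Analysis" "HOL-Computational_Algebra.Polynomial"
begin

text \<open>
  Complex Hilbert spaces as a type class on top of \<^class>\<open>banach\<close>.  The complex scalar action
  extends the real one, the inner product is linear in its first argument, and the norm (hence
  completeness) is the one it induces; definiteness is inherited from the norm.
\<close>

class chilbert_space = banach +
  fixes scaleC :: "complex \<Rightarrow> 'a \<Rightarrow> 'a" (infixr \<open>*\<^sub>C\<close> 75)
    and cinner :: "'a \<Rightarrow> 'a \<Rightarrow> complex"
  assumes scaleC_add_right: "c *\<^sub>C (x + y) = c *\<^sub>C x + c *\<^sub>C y"
    and scaleC_add_left: "(c + d) *\<^sub>C x = c *\<^sub>C x + d *\<^sub>C x"
    and scaleC_scaleC: "c *\<^sub>C d *\<^sub>C x = (c * d) *\<^sub>C x"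
    and scaleC_of_real: "complex_of_real r *\<^sub>C x = r *\<^sub>R x"
    and cinner_add_left: "cinner (x + y) z = cinner x z + cinner y z"
    and cinner_scaleC_left: "cinner (c *\<^sub>C x) y = c * cinner x y"
    and cinner_commute: "cinner x y = cnj (cinner y x)"
    and cinner_self: "cinner x x = complex_of_real ((norm x)\<^sup>2)"

instantiation complex :: chilbert_space
begin

definition scaleC_complex :: "complex \<Rightarrow> complex \<Rightarrow> complex" where
  "scaleC_complex c x = c * x"

definition cinner_complex :: "complex \<Rightarrow> complex \<Rightarrow> complex" where
  "cinner_complex x y = x * cnj y"

instance
proof
  show "cinner x y = cnj (cinner y x)" for x y :: complex
    by (simp add: cinner_complex_def mult.commute)
  show "cinner x x = complex_of_real ((norm x)\<^sup>2)" for x :: complex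
    unfolding cinner_complex_def complex_norm_square ..
qed (simp_all add: scaleC_complex_def cinner_complex_def algebra_simps scaleR_conv_of_real)

end

text \<open>
  The type of bounded real-linear maps is \<open>'a \<Rightarrow>\<^sub>L 'a\<close>; its complex-linear members form the
  algebra \<open>B(H)\<close>.
\<close>

definition clinear_op :: "('a::chilbert_space \<Rightarrow>\<^sub>L 'a) \<Rightarrow> bool" where
  "clinear_op X \<longleftrightarrow> (\<forall>c x. blinfun_apply X (c *\<^sub>C x) = c *\<^sub>C blinfun_apply X x)"

definition self_adjoint :: "('a::chilbert_space \<Rightarrow>\<^sub>L 'a) \<Rightarrow> bool" where
  "self_adjoint X \<longleftrightarrow> clinear_op X \<and>
     (\<forall>x y. cinner (blinfun_apply X x) y = cinner x (blinfun_apply X y))"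

definition positive_op :: "('a::chilbert_space \<Rightarrow>\<^sub>L 'a) \<Rightarrow> bool" where
  "positive_op X \<longleftrightarrow> self_adjoint X \<and> (\<forall>x. 0 \<le> Re (cinner (blinfun_apply X x) x))"

definition invertible_op :: "('a::chilbert_space \<Rightarrow>\<^sub>L 'a) \<Rightarrow> bool" where
  "invertible_op X \<longleftrightarrow>
     (\<exists>Y. clinear_op Y \<and> X o\<^sub>L Y = id_blinfun \<and> Y o\<^sub>L X = id_blinfun)"

definition strictly_positive :: "('a::chilbert_space \<Rightarrow>\<^sub>L 'a) \<Rightarrow> bool" where
  "strictly_positive X \<longleftrightarrow> positive_op X \<and> invertible_op X"

definition loewner_le :: "('a::chilbert_space \<Rightarrow>\<^sub>L 'a) \<Rightarrow> ('a \<Rightarrow>\<^sub>L 'a) \<Rightarrow> bool"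
    (infix \<open>\<preceq>\<close> 50) where
  "X \<preceq> Y \<longleftrightarrow> self_adjoint X \<and> self_adjoint Y \<and> positive_op (Y - X)"

definition scalar_op :: "complex \<Rightarrow> ('a::chilbert_space \<Rightarrow>\<^sub>L 'a)" where
  "scalar_op z = Blinfun (\<lambda>x. z *\<^sub>C x)"

lemma norm_scaleC: "norm (c *\<^sub>C x) = cmod c * norm (x :: 'a::chilbert_space)"
proof -
  have "complex_of_real ((norm (c *\<^sub>C x))\<^sup>2) = c * cnj (c * cinner x x)"
    unfolding cinner_self [symmetric] cinner_scaleC_left cinner_commute [of x "c *\<^sub>C x"] ..
  also have "\<dots> = complex_of_real ((cmod c * norm x)\<^sup>2)"
    unfolding cinner_self power_mult_distrib of_real_mult complex_norm_square complex_cnj_mult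
      complex_cnj_complex_of_real mult.assoc ..
  finally have "(norm (c *\<^sub>C x))\<^sup>2 = (cmod c * norm x)\<^sup>2"
    by (simp only: of_real_eq_iff)
  then show ?thesis
    by (simp add: power2_eq_iff_nonneg)
qed

lemma scalar_op_apply [simp]:
  "blinfun_apply (scalar_op z) (x :: 'a::chilbert_space) = z *\<^sub>C x"
proof -
  have "bounded_linear (\<lambda>x :: 'a. z *\<^sub>C x)"
  proof (rule bounded_linear_intro[where K = "cmod z"])
    show "z *\<^sub>C (r *\<^sub>R x) = r *\<^sub>R (z *\<^sub>C x)" for r and x :: 'a
      unfolding scaleC_of_real [symmetric] scaleC_scaleC mult.commute [of z] ..
  qed (simp_all add: scaleC_add_right norm_scaleC mult.commute)
  then show ?thesis
    by (simp add: scalar_op_def bounded_linear_Blinfun_apply)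
qed

definition op_spectrum :: "('a::chilbert_space \<Rightarrow>\<^sub>L 'a) \<Rightarrow> complex set" where
  "op_spectrum X = {z. \<not> invertible_op (X - scalar_op z)}"

definition op_power :: "('a::chilbert_space \<Rightarrow>\<^sub>L 'a) \<Rightarrow> nat \<Rightarrow> ('a \<Rightarrow>\<^sub>L 'a)" where
  "op_power X n = ((\<lambda>Y. X o\<^sub>L Y) ^^ n) id_blinfun"

definition poly_op :: "real poly \<Rightarrow> ('a::chilbert_space \<Rightarrow>\<^sub>L 'a) \<Rightarrow> ('a \<Rightarrow>\<^sub>L 'a)" where
  "poly_op q X = (\<Sum>i\<le>degree q. coeff q i *\<^sub>R op_power X i)"

text \<open>
  Continuous functional calculus \<open>f(X)\<close> for self-adjoint \<open>X\<close> and real-valued \<open>f\<close> continuous on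
  the spectrum of \<open>X\<close>: the common norm limit of \<open>q\<^sub>n(X)\<close> over all sequences of real polynomials
  converging to \<open>f\<close> uniformly on the spectrum.  The spectrum of a self-adjoint operator is real,
  so restricting to its real points loses nothing.  Outside these hypotheses on \<open>X\<close> and \<open>f\<close> the
  value carries no meaning.
\<close>

definition fun_calc :: "(real \<Rightarrow> real) \<Rightarrow> ('a::chilbert_space \<Rightarrow>\<^sub>L 'a) \<Rightarrow> ('a \<Rightarrow>\<^sub>L 'a)" where
  "fun_calc f X = (THE Y. \<forall>q :: nat \<Rightarrow> real poly.
     uniform_limit {t. complex_of_real t \<in> op_spectrum X} (\<lambda>n. poly (q n)) f sequentially \<longrightarrow>
     (\<lambda>n. poly_op (q n) X) \<longlonglongrightarrow> Y)"

text \<open>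
  Real powers and the logarithm are meant for strictly positive \<open>X\<close>, whose spectrum lies in
  the open positive half-line, where \<open>\<lambda>t. t powr r\<close> and \<^const>\<open>ln\<close> are the usual functions.
\<close>

definition op_powr :: "('a::chilbert_space \<Rightarrow>\<^sub>L 'a) \<Rightarrow> real \<Rightarrow> ('a \<Rightarrow>\<^sub>L 'a)" where
  "op_powr X r = fun_calc (\<lambda>t. t powr r) X"

definition op_log :: "('a::chilbert_space \<Rightarrow>\<^sub>L 'a) \<Rightarrow> ('a \<Rightarrow>\<^sub>L 'a)" where
  "op_log X = fun_calc ln X"

text \<open>The operator \<open>A\<^sup>-\<^sup>1\<^sup>/\<^sup>2 B A\<^sup>-\<^sup>1\<^sup>/\<^sup>2\<close>.\<close>

definition rel_quot :: "('a::chilbert_space \<Rightarrow>\<^sub>L 'a) \<Rightarrow> ('a \<Rightarrow>\<^sub>L 'a) \<Rightarrow> ('a \<Rightarrow>\<^sub>L 'a)" where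
  "rel_quot A B = op_powr A (-1/2) o\<^sub>L B o\<^sub>L op_powr A (-1/2)"

definition rel_entropy :: "('a::chilbert_space \<Rightarrow>\<^sub>L 'a) \<Rightarrow> ('a \<Rightarrow>\<^sub>L 'a) \<Rightarrow> ('a \<Rightarrow>\<^sub>L 'a)" where
  "rel_entropy A B = op_powr A (1/2) o\<^sub>L op_log (rel_quot A B) o\<^sub>L op_powr A (1/2)"

definition gen_rel_entropy ::
    "real \<Rightarrow> ('a::chilbert_space \<Rightarrow>\<^sub>L 'a) \<Rightarrow> ('a \<Rightarrow>\<^sub>L 'a) \<Rightarrow> ('a \<Rightarrow>\<^sub>L 'a)" where
  "gen_rel_entropy r A B =
     op_powr A (1/2) o\<^sub>L op_powr (rel_quot A B) r o\<^sub>L op_log (rel_quot A B) o\<^sub>L op_powr A (1/2)"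

definition tsallis_rel_entropy ::
    "real \<Rightarrow> ('a::chilbert_space \<Rightarrow>\<^sub>L 'a) \<Rightarrow> ('a \<Rightarrow>\<^sub>L 'a) \<Rightarrow> ('a \<Rightarrow>\<^sub>L 'a)" where
  "tsallis_rel_entropy p A B =
     ((op_powr A (1/2) o\<^sub>L op_powr (rel_quot A B) p o\<^sub>L op_powr A (1/2)) - A) /\<^sub>R p"

end

theory Submission
  imports Defs "HOL-Computational_Algebra.Fundamental_Theorem_Algebra"
begin

text \<open>
  A real polynomial without roots in the spectrum of a self-adjoint \<open>X\<close> is a product of invertible
  factors when evaluated at \<open>X\<close>: a linear factor \<open>X - t\<close> is invertible for \<open>t\<close> outside the spectrum,
  and a quadratic factor \<open>(X - a)\<^sup>2 + b\<^sup>2\<close> is coercive.  On the other hand \<open>Y\<^sup>2 - \<parallel>Y\<parallel>\<^sup>2\<close> is never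
  invertible for self-adjoint \<open>Y\<close>; for \<open>Y = q(X)\<close> this forces \<open>\<bar>q\<bar> = \<parallel>q(X)\<parallel>\<close> somewhere on the
  spectrum.  Hence \<open>\<parallel>q(X)\<parallel> \<le> sup \<bar>q\<bar>\<close>, so that the functional calculus is well defined and
  multiplicative, and therefore monotone, since \<open>f(X) = (\<surd>f)(X)\<^sup>2\<close> for \<open>f \<ge> 0\<close>.

  All the entropies have the form \<open>A\<^sup>1\<^sup>/\<^sup>2 f(X) A\<^sup>1\<^sup>/\<^sup>2\<close> with \<open>X = A\<^sup>-\<^sup>1\<^sup>/\<^sup>2 B A\<^sup>-\<^sup>1\<^sup>/\<^sup>2\<close>, whose spectrum
  lies in \<open>[u, v]\<close>, so the inequalities reduce to inequalities between the scalar functions \<open>f\<close>.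
\<close>

section \<open>The real inner product and coercive operators\<close>

text \<open>The real part induces the same norm and is bilinear over the reals, so that the theory
  of bounded bilinear maps applies to it; the complex product is sesquilinear.\<close>

definition rinner :: "'a::chilbert_space \<Rightarrow> 'a \<Rightarrow> real" where
  "rinner x y = Re (cinner x y)"

lemma rinner_commute: "rinner x y = rinner y x"
  unfolding rinner_def by (subst cinner_commute) simp

lemma rinner_self: "rinner x x = (norm x)\<^sup>2"
  by (simp add: rinner_def cinner_self)

lemma rinner_add_left: "rinner (x + y) z = rinner x z + rinner y z"
  by (simp add: rinner_def cinner_add_left)

lemma rinner_scaleR_left: "rinner (r *\<^sub>R x) y = r * rinner x y"
  by (simp add: rinner_def cinner_scaleC_left flip: scaleC_of_real)

lemma norm_diff_squared:
  "(norm (x - y))\<^sup>2 = (norm x)\<^sup>2 - 2 * rinner x y + (norm (y::'a::chilbert_space))\<^sup>2"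
proof -
  have "rinner (x - y) (x - y) = rinner x x - 2 * rinner x y + rinner y y"
    using rinner_add_left [of "x - y" y x] rinner_add_left [of "x - y" y y]
      rinner_add_left [of "x - y" y "x - y"]
    by (simp add: rinner_commute)
  then show ?thesis
    by (simp add: rinner_self)
qed

text \<open>Cauchy-Schwarz, by expanding the squared norm of
  \<open>norm y *\<^sub>R x - norm x *\<^sub>R y\<close>. The factor
  \<open>2 * (norm x * norm y)\<close> can be cancelled unless one of the vectors is zero.\<close>

lemma rinner_le_norm: "rinner x y \<le> norm x * norm y"
proof -
  have "0 \<le> (norm (norm y *\<^sub>R x - norm x *\<^sub>R y))\<^sup>2"
    by simp
  also have "\<dots> = 2 * (norm x * norm y) * (norm x * norm y - rinner x y)"
    unfolding norm_diff_squared
    by (simp add: rinner_scaleR_left rinner_commute [of x "norm x *\<^sub>R y"]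
        rinner_commute [of y x] power_mult_distrib algebra_simps power2_eq_square)
  finally show ?thesis
  proof (cases "x = 0 \<or> y = 0")
    case True
    then show ?thesis
      using rinner_scaleR_left [of 0 0 y] rinner_scaleR_left [of 0 0 x]
      by (auto simp: rinner_commute)
  next
    case False
    assume *: "0 \<le> 2 * (norm x * norm y) * (norm x * norm y - rinner x y)"
    from False have "0 < 2 * (norm x * norm y)"
      by simp
    with * have "0 \<le> norm x * norm y - rinner x y"
      by (simp only: zero_le_mult_iff) linarith
    then show ?thesis
      by simp
  qed
qed

interpretation rinner: bounded_bilinear rinner
proof
  show add_l: "rinner (x + y) z = rinner x z + rinner y z" for x y z :: 'a
    by (rule rinner_add_left)
  show "rinner z (x + y) = rinner z x + rinner z y" for x y z :: 'a
    by (simp add: rinner_commute [of z] rinner_add_left)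
  show scale: "rinner (r *\<^sub>R x) y = r *\<^sub>R rinner x y" for r and x y :: 'a
    by (simp add: rinner_scaleR_left)
  show "rinner x (r *\<^sub>R y) = r *\<^sub>R rinner x y" for r and x y :: 'a
    by (simp add: rinner_commute [of x] rinner_scaleR_left)
  \<comment> \<open>Cauchy-Schwarz at \<open>x\<close> and at \<open>-x\<close> bounds the absolute
    value.\<close>
  have "\<bar>rinner x y\<bar> \<le> norm x * norm y" for x y :: 'a
    using rinner_le_norm [of x y] rinner_le_norm [of "(-1) *\<^sub>R x" y]
    unfolding rinner_scaleR_left by simp
  then show "\<exists>K. \<forall>x y :: 'a. norm (rinner x y) \<le> norm x * norm y * K"
    by (intro exI [of _ 1]) simp
qed

text \<open>The imaginary part of \<open>cinner x y\<close> is
  \<open>- rinner (\<i> *\<^sub>C x) y\<close>, and complex linearity moves the factor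
  \<open>\<i>\<close> through \<open>X\<close>. Real symmetry therefore suffices.\<close>

lemma self_adjoint_iff_rinner:
  "self_adjoint X \<longleftrightarrow>
     clinear_op X \<and> (\<forall>x y. rinner (X x) y = rinner x (blinfun_apply X y))"
proof safe
  assume "clinear_op X" and sym: "\<forall>x y. rinner (X x) y = rinner x (blinfun_apply X y)"
  have Im: "Im (cinner x y) = - rinner (\<i> *\<^sub>C x) y" for x y :: 'a
    by (simp add: rinner_def cinner_scaleC_left)
  have "cinner (X x) y = cinner x (X y)" for x y
  proof (rule complex_eqI)
    show "Re (cinner (X x) y) = Re (cinner x (X y))"
      using sym by (simp add: rinner_def)
    have "rinner (\<i> *\<^sub>C X x) y = rinner (\<i> *\<^sub>C x) (X y)"
      using sym \<open>clinear_op X\<close> unfolding clinear_op_def by metis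
    then show "Im (cinner (X x) y) = Im (cinner x (X y))"
      by (simp only: Im)
  qed
  with \<open>clinear_op X\<close> show "self_adjoint X"
    by (simp add: self_adjoint_def)
qed (simp_all add: self_adjoint_def rinner_def)

lemma positive_op_iff_rinner: "positive_op X \<longleftrightarrow> self_adjoint X \<and> (\<forall>x. 0 \<le> rinner (X x) x)"
  by (simp add: positive_op_def rinner_def)

lemma self_adjointD: "self_adjoint X \<Longrightarrow> rinner (X x) y = rinner x (X y)"
  by (simp add: self_adjoint_iff_rinner)

section \<open>Algebra of complex-linear and self-adjoint operators\<close>

lemma scaleC_scaleR_commute: "c *\<^sub>C (r *\<^sub>R x) = r *\<^sub>R (c *\<^sub>C (x::'a::chilbert_space))"
  unfolding scaleC_of_real [symmetric] scaleC_scaleC mult.commute [of c] ..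

lemma blinfun_compose_id [simp]: "X o\<^sub>L id_blinfun = X" "id_blinfun o\<^sub>L X = X"
  by (auto intro: blinfun_eqI)

lemma clinear_op_id: "clinear_op id_blinfun"
  and clinear_op_zero: "clinear_op 0"
  and clinear_op_add: "clinear_op X \<Longrightarrow> clinear_op Y \<Longrightarrow> clinear_op (X + Y)"
  and clinear_op_scaleR: "clinear_op X \<Longrightarrow> clinear_op (r *\<^sub>R X)"
  and clinear_op_compose: "clinear_op X \<Longrightarrow> clinear_op Y \<Longrightarrow> clinear_op (X o\<^sub>L Y)"
proof -
  show "clinear_op 0"
    unfolding clinear_op_def using scaleC_add_right [of _ 0 0]
    by (metis add_cancel_left_left blinfun.zero_left)
qed (simp_all add: clinear_op_def blinfun.bilinear_simps scaleC_add_right scaleC_scaleR_commute)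

lemma self_adjoint_id: "self_adjoint id_blinfun"
  and self_adjoint_zero: "self_adjoint 0"
  and self_adjoint_add: "self_adjoint X \<Longrightarrow> self_adjoint Y \<Longrightarrow> self_adjoint (X + Y)"
  and self_adjoint_scaleR: "self_adjoint X \<Longrightarrow> self_adjoint (r *\<^sub>R X)"
  by (simp_all add: self_adjoint_iff_rinner clinear_op_id clinear_op_zero clinear_op_add
      clinear_op_scaleR blinfun.bilinear_simps rinner.add_left rinner.add_right
      rinner.scaleR_left rinner.scaleR_right rinner.zero_left rinner.zero_right)

lemma self_adjoint_diff: "self_adjoint X \<Longrightarrow> self_adjoint Y \<Longrightarrow> self_adjoint (X - Y)"
  using self_adjoint_add [of X "(-1) *\<^sub>R Y"] self_adjoint_scaleR [of Y "-1"] by simp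

lemma self_adjoint_compose_commuting:
  assumes "self_adjoint X" "self_adjoint Y" "X o\<^sub>L Y = Y o\<^sub>L X"
  shows "self_adjoint (X o\<^sub>L Y)"
proof -
  have "X (Y y) = Y (X y)" for y
    using arg_cong [OF assms(3), of "\<lambda>Z. blinfun_apply Z y"] by simp
  then show ?thesis
    using assms(1,2) by (simp add: self_adjoint_iff_rinner clinear_op_compose)
qed

lemma self_adjoint_conjugate:
  assumes "self_adjoint R" "self_adjoint X"
  shows "self_adjoint (R o\<^sub>L X o\<^sub>L R)"
  using assms by (simp add: self_adjoint_iff_rinner clinear_op_compose)

text \<open>The quadratic form of the difference at \<open>x\<close> is the form of
  \<open>Y - X\<close> at \<open>R x\<close>.\<close>

lemma loewner_le_conjugate:
  assumes "self_adjoint R" "X \<preceq> Y"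
  shows "R o\<^sub>L X o\<^sub>L R \<preceq> R o\<^sub>L Y o\<^sub>L R"
proof -
  have "rinner (((R o\<^sub>L Y o\<^sub>L R) - (R o\<^sub>L X o\<^sub>L R)) x) x = rinner ((Y - X) (R x)) (R x)" for x
    using assms(1) by (simp add: blinfun.bilinear_simps rinner.diff_left self_adjointD)
  with assms show ?thesis
    by (auto simp: loewner_le_def positive_op_iff_rinner self_adjoint_conjugate
        intro!: self_adjoint_diff)
qed

text \<open>
  Lax--Milgram: \<open>X x = y\<close> is solved by the fixed point of \<open>x \<mapsto> x - e (X x - y)\<close>, a contraction
  for \<open>e = c / M\<^sup>2\<close>.
\<close>

lemma coercive_imp_invertible_op:
  fixes X :: "'a::chilbert_space \<Rightarrow>\<^sub>L 'a"
  assumes lin: "clinear_op X" and "0 < c"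
    and coercive: "\<And>x. c * (norm x)\<^sup>2 \<le> rinner (X x) x"
  shows "invertible_op X"
proof -
  \<comment> \<open>The summand \<open>c\<close> yields both \<open>0 < M\<close> and
    \<open>c \<le> M\<close>, so that \<open>1 - c\<^sup>2 / M\<^sup>2\<close> is
    nonnegative.\<close>
  define M where "M = norm X + c"
  have "0 < M" "c \<le> M"
    using \<open>0 < c\<close> by (simp_all add: M_def add_nonneg_pos)
  have bound: "norm (X x) \<le> M * norm x" for x
    using norm_blinfun [of X x] \<open>0 < c\<close>
    by (simp add: M_def distrib_right add_increasing2)
  \<comment> \<open>This value minimises \<open>1 - 2 * e * c + e\<^sup>2 * M\<^sup>2\<close>, the
    bound on the squared Lipschitz constant.\<close>
  define e where "e = c / M\<^sup>2"
  have "0 < e"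
    using \<open>0 < c\<close> \<open>0 < M\<close> by (simp add: e_def)
  \<comment> \<open>This gives injectivity of \<open>X\<close>, and later the bound
    \<open>1 / c\<close> on its inverse \<open>g\<close>. Linearity of \<open>g\<close> also follows
    from injectivity.\<close>
  have inj_bound: "c * norm x \<le> norm (X x)" for x
  proof (cases "x = 0")
    case False
    have "c * norm x * norm x \<le> norm (X x) * norm x"
      using coercive [of x] rinner_le_norm [of "X x" x] by (simp add: power2_eq_square mult.assoc)
    with False show ?thesis
      by simp
  qed simp
  have "\<exists>!x. x - e *\<^sub>R (X x - y) = x" for y
  proof (rule banach_fix_type)
    have "c\<^sup>2 / M\<^sup>2 \<le> 1"
      using \<open>c \<le> M\<close> \<open>0 < c\<close> \<open>0 < M\<close> by (simp add: power_mono)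
    then show "0 \<le> sqrt (1 - c\<^sup>2 / M\<^sup>2)"
      by simp
    show "sqrt (1 - c\<^sup>2 / M\<^sup>2) < 1"
      using \<open>0 < c\<close> \<open>0 < M\<close> by simp
    show "\<forall>x z. dist (x - e *\<^sub>R (X x - y)) (z - e *\<^sub>R (X z - y)) \<le> sqrt (1 - c\<^sup>2 / M\<^sup>2) * dist x z"
    proof safe
      fix x z :: 'a
      let ?d = "x - z"
      have "(x - e *\<^sub>R (X x - y)) - (z - e *\<^sub>R (X z - y)) = ?d - e *\<^sub>R X ?d"
        by (simp add: blinfun.bilinear_simps algebra_simps)
      then have "(dist (x - e *\<^sub>R (X x - y)) (z - e *\<^sub>R (X z - y)))\<^sup>2 = (norm (?d - e *\<^sub>R X ?d))\<^sup>2"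
        by (simp only: dist_norm)
      also have "\<dots> = (norm ?d)\<^sup>2 - 2 * e * rinner (X ?d) ?d + e\<^sup>2 * (norm (X ?d))\<^sup>2"
        by (simp add: norm_diff_squared [of ?d] rinner.scaleR_right rinner_commute [of ?d]
            power_mult_distrib)
      also have "\<dots> \<le> (norm ?d)\<^sup>2 - 2 * e * (c * (norm ?d)\<^sup>2) + e\<^sup>2 * (M * norm ?d)\<^sup>2"
        using coercive [of ?d] bound [of ?d] \<open>0 < e\<close>
        by (intro add_mono diff_mono mult_left_mono power_mono) auto
      also have "\<dots> = (1 - c\<^sup>2 / M\<^sup>2) * (norm ?d)\<^sup>2"
        using \<open>0 < M\<close> by (simp add: e_def field_simps power2_eq_square)
      also have "\<dots> = (sqrt (1 - c\<^sup>2 / M\<^sup>2) * dist x z)\<^sup>2"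
        using \<open>c\<^sup>2 / M\<^sup>2 \<le> 1\<close> by (simp add: power_mult_distrib dist_norm)
      finally show "dist (x - e *\<^sub>R (X x - y)) (z - e *\<^sub>R (X z - y)) \<le> sqrt (1 - c\<^sup>2 / M\<^sup>2) * dist x z"
        using \<open>c\<^sup>2 / M\<^sup>2 \<le> 1\<close> by (intro power2_le_imp_le [OF _ mult_nonneg_nonneg]) auto
    qed
  qed
  then have "\<exists>x. X x = y" for y
    using \<open>0 < e\<close> by (force dest!: ex1_implies_ex)
  then obtain g where g: "X (g y) = y" for y
    by metis
  have inj: "x = z" if "X x = X z" for x z
    using inj_bound [of "x - z"] that \<open>0 < c\<close>
    by (simp add: blinfun.bilinear_simps mult_le_0_iff)
  have "bounded_linear g"
  proof (rule bounded_linear_intro)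
    show "g (x + y) = g x + g y" and "g (r *\<^sub>R x) = r *\<^sub>R g x" for x y r
      by (rule inj, simp add: blinfun.bilinear_simps g)+
    show "norm (g x) \<le> norm x * (1 / c)" for x
      using inj_bound [of "g x"] \<open>0 < c\<close> by (simp add: g field_simps)
  qed
  then have app: "Blinfun g x = g x" for x
    by (simp add: bounded_linear_Blinfun_apply)
  have "clinear_op (Blinfun g)"
    unfolding clinear_op_def app
  proof safe
    show "g (k *\<^sub>C x) = k *\<^sub>C g x" for k x
      by (rule inj) (use lin in \<open>simp add: clinear_op_def g\<close>)
  qed
  moreover have "X o\<^sub>L Blinfun g = id_blinfun"
    by (rule blinfun_eqI) (simp add: app g)
  moreover have "Blinfun g o\<^sub>L X = id_blinfun"
    by (rule blinfun_eqI, rule inj) (simp add: app g)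
  ultimately show ?thesis
    unfolding invertible_op_def by blast
qed

section \<open>Invertible operators and lower bounds\<close>

lemma invertible_op_compose:
  assumes "invertible_op X" "invertible_op Y"
  shows "invertible_op (X o\<^sub>L Y)"
proof -
  obtain X' Y' where *: "clinear_op X'" "X o\<^sub>L X' = id_blinfun" "X' o\<^sub>L X = id_blinfun"
      "clinear_op Y'" "Y o\<^sub>L Y' = id_blinfun" "Y' o\<^sub>L Y = id_blinfun"
    using assms unfolding invertible_op_def by blast
  have "X o\<^sub>L Y o\<^sub>L (Y' o\<^sub>L X') = X o\<^sub>L (Y o\<^sub>L Y') o\<^sub>L X'"
      "Y' o\<^sub>L X' o\<^sub>L (X o\<^sub>L Y) = Y' o\<^sub>L (X' o\<^sub>L X) o\<^sub>L Y"
    by (rule blinfun_eqI, simp)+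
  with * show ?thesis
    unfolding invertible_op_def
    by (intro exI [of _ "Y' o\<^sub>L X'"]) (simp add: clinear_op_compose)
qed

lemma invertible_op_scaleR:
  assumes "invertible_op X" "r \<noteq> 0"
  shows "invertible_op (r *\<^sub>R X)"
proof -
  obtain Y where *: "clinear_op Y" "X o\<^sub>L Y = id_blinfun" "Y o\<^sub>L X = id_blinfun"
    using assms unfolding invertible_op_def by blast
  have "r *\<^sub>R X o\<^sub>L inverse r *\<^sub>R Y = X o\<^sub>L Y" "inverse r *\<^sub>R Y o\<^sub>L r *\<^sub>R X = Y o\<^sub>L X"
    using assms(2) by (auto intro!: blinfun_eqI simp: blinfun.bilinear_simps)
  with * show ?thesis
    unfolding invertible_op_def
    by (intro exI [of _ "inverse r *\<^sub>R Y"]) (simp add: clinear_op_scaleR)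
qed

lemma invertible_op_id: "invertible_op id_blinfun"
  unfolding invertible_op_def by (auto intro!: exI [of _ id_blinfun] clinear_op_id blinfun_eqI)

text \<open>The norm of an inverse serves as the constant; the added 1 keeps it positive even on the
  zero space.\<close>

lemma invertible_op_bounded_below:
  assumes "invertible_op X"
  obtains K where "0 < K" "\<And>x. norm x \<le> K * norm (blinfun_apply X x)"
proof -
  obtain Y where Y: "Y o\<^sub>L X = id_blinfun"
    using assms unfolding invertible_op_def by blast
  show ?thesis
  proof
    show "0 < norm Y + 1"
      by (simp add: add_nonneg_pos)
    show "norm x \<le> (norm Y + 1) * norm (X x)" for x
    proof -
      have "Y (X x) = x"
        using arg_cong [OF Y, of "\<lambda>Z. blinfun_apply Z x"] by simp
      then have "norm x \<le> norm Y * norm (X x)"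
        using norm_blinfun [of Y "X x"] by simp
      then show ?thesis
        by (simp add: distrib_right add_increasing2)
    qed
  qed
qed

text \<open>Expanding \<open>\<parallel>X\<^sup>2 x - m\<^sup>2 x\<parallel>\<^sup>2\<close> shows that it is small whenever \<open>\<parallel>X x\<parallel>\<close> is close to \<open>m \<parallel>x\<parallel>\<close>.\<close>

lemma square_minus_norm_square_not_invertible:
  fixes X :: "'a::chilbert_space \<Rightarrow>\<^sub>L 'a" and x\<^sub>0 :: 'a
  assumes "self_adjoint X" "x\<^sub>0 \<noteq> 0"
  shows "\<not> invertible_op ((X o\<^sub>L X) - (norm X)\<^sup>2 *\<^sub>R id_blinfun)"
proof
  let ?m = "norm X"
  assume "invertible_op ((X o\<^sub>L X) - ?m\<^sup>2 *\<^sub>R id_blinfun)"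
  then obtain K where "0 < K"
    and K: "\<And>x. norm x \<le> K * norm (((X o\<^sub>L X) - ?m\<^sup>2 *\<^sub>R id_blinfun) x)"
    by (rule invertible_op_bounded_below) blast
  have *: "(norm x)\<^sup>2 \<le> K\<^sup>2 * (2 * ?m^4 * (norm x)\<^sup>2 - 2 * ?m\<^sup>2 * (norm (X x))\<^sup>2)" for x
  proof -
    have "(norm x)\<^sup>2 \<le> (K * norm (((X o\<^sub>L X) - ?m\<^sup>2 *\<^sub>R id_blinfun) x))\<^sup>2"
      using K [of x] by (intro power_mono) auto
    also have "\<dots> = K\<^sup>2 * (norm (X (X x) - ?m\<^sup>2 *\<^sub>R x))\<^sup>2"
      by (simp add: power_mult_distrib blinfun.bilinear_simps)
    also have "(norm (X (X x) - ?m\<^sup>2 *\<^sub>R x))\<^sup>2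
        = (norm (X (X x)))\<^sup>2 - 2 * ?m\<^sup>2 * (norm (X x))\<^sup>2 + ?m^4 * (norm x)\<^sup>2"
      using assms(1) by (simp add: norm_diff_squared rinner.scaleR_right self_adjointD [of X "X x" x]
          rinner_self power_mult_distrib flip: power_mult)
    also have "K\<^sup>2 * ((norm (X (X x)))\<^sup>2 - 2 * ?m\<^sup>2 * (norm (X x))\<^sup>2 + ?m^4 * (norm x)\<^sup>2)
        \<le> K\<^sup>2 * (?m^4 * (norm x)\<^sup>2 - 2 * ?m\<^sup>2 * (norm (X x))\<^sup>2 + ?m^4 * (norm x)\<^sup>2)"
    proof -
      have "norm (X (X x)) \<le> ?m * (?m * norm x)"
        using norm_blinfun [of X x] norm_blinfun [of X "X x"]
        by (meson mult_left_mono norm_ge_zero order_trans)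
      then have "(norm (X (X x)))\<^sup>2 \<le> (?m * (?m * norm x))\<^sup>2"
        by (intro power_mono) auto
      also have "\<dots> = ?m^4 * (norm x)\<^sup>2"
        by (simp add: power_mult_distrib mult.assoc [symmetric] flip: power_add)
      finally show ?thesis
        by (intro mult_left_mono add_right_mono diff_right_mono) auto
    qed
    finally show ?thesis
      by (simp add: algebra_simps)
  qed
  show False
  proof (cases "?m = 0")
    case True
    with * [of x\<^sub>0] assms(2) show False
      by simp
  next
    case False
    \<comment> \<open>Solving \<open>*\<close> for \<open>(norm (X x))\<^sup>2\<close> gives this
      factor. It lies strictly below \<open>?m\<^sup>2\<close>, contradicting that \<open>?m\<close>
      is the least bound for \<open>X\<close>.\<close>
    define s where "s = ?m\<^sup>2 - 1 / (2 * K\<^sup>2 * ?m\<^sup>2)"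
    have bound: "(norm (X x))\<^sup>2 \<le> s * (norm x)\<^sup>2" for x
      using * [of x] \<open>0 < K\<close> False
      by (simp add: s_def field_simps power2_eq_square power4_eq_xxxx)
    have "0 \<le> s * (norm x\<^sub>0)\<^sup>2"
      using order_trans [OF zero_le_power2 bound [of x\<^sub>0]] .
    then have "0 \<le> s"
      using assms(2) by (simp add: zero_le_mult_iff)
    have "norm X \<le> sqrt s"
    proof (rule norm_blinfun_bound)
      show "norm (X x) \<le> sqrt s * norm x" for x
      proof (rule power2_le_imp_le)
        show "(norm (X x))\<^sup>2 \<le> (sqrt s * norm x)\<^sup>2"
          using bound [of x] \<open>0 \<le> s\<close> by (simp add: power_mult_distrib)
      qed (use \<open>0 \<le> s\<close> in simp)
    qed (use \<open>0 \<le> s\<close> in simp)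
    then have "?m\<^sup>2 \<le> (sqrt s)\<^sup>2"
      by (intro power_mono) auto
    also have "\<dots> = s"
      using \<open>0 \<le> s\<close> by simp
    also have "\<dots> < ?m\<^sup>2"
    proof -
      have "0 < 1 / (2 * K\<^sup>2 * ?m\<^sup>2)"
        using \<open>0 < K\<close> False by simp
      then show ?thesis
        by (simp add: s_def)
    qed
    finally show False
      by simp
  qed
qed

section \<open>Polynomials in a self-adjoint operator\<close>

lemma op_power_Suc: "op_power X (Suc n) = X o\<^sub>L op_power X n"
  by (simp add: op_power_def)

text \<open>The extra coefficients vanish; a common range of summation lets polynomials of different
  degrees be added termwise.\<close>

lemma poly_op_eq_sum:
  assumes "degree q \<le> n"
  shows "poly_op q X = (\<Sum>i\<le>n. coeff q i *\<^sub>R op_power X i)"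
  unfolding poly_op_def using assms by (intro sum.mono_neutral_left) (auto simp: coeff_eq_0)

lemma poly_op_0 [simp]: "poly_op 0 X = 0"
  by (simp add: poly_op_def)

lemma poly_op_add: "poly_op (p + q) X = poly_op p X + poly_op q X"
proof -
  let ?n = "max (degree p) (degree q)"
  have "degree (p + q) \<le> ?n"
    by (rule degree_add_le_max)
  then show ?thesis
    by (simp add: poly_op_eq_sum [of _ ?n] sum.distrib scaleR_add_left)
qed

lemma poly_op_smult: "poly_op (smult c q) X = c *\<^sub>R poly_op q X"
  by (simp add: poly_op_eq_sum [of "smult c q" "degree q"] poly_op_eq_sum [of q "degree q"]
      degree_smult_le scaleR_sum_right)

lemma poly_op_diff: "poly_op (p - q) X = poly_op p X - poly_op q X"
  using poly_op_add [of p "smult (-1) q" X] poly_op_smult [of "-1" q X] by simp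

text \<open>The Horner recursion, which opens \<open>poly_op\<close> to induction over
  \<open>pCons\<close>.\<close>

lemma poly_op_pCons: "poly_op (pCons c q) X = c *\<^sub>R id_blinfun + (X o\<^sub>L poly_op q X)"
proof -
  have "poly_op (pCons c q) X = (\<Sum>i\<le>Suc (degree q). coeff (pCons c q) i *\<^sub>R op_power X i)"
    by (intro poly_op_eq_sum degree_pCons_le)
  also have "\<dots> = c *\<^sub>R op_power X 0 + (\<Sum>i\<le>degree q. coeff q i *\<^sub>R op_power X (Suc i))"
    by (subst sum.atMost_Suc_shift) simp
  also have "(\<Sum>i\<le>degree q. coeff q i *\<^sub>R op_power X (Suc i)) = X o\<^sub>L poly_op q X"
    by (simp add: poly_op_def op_power_Suc bounded_bilinear.sum_right
        [OF bounded_bilinear_blinfun_compose] bounded_bilinear.scaleR_right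
        [OF bounded_bilinear_blinfun_compose])
  finally show ?thesis
    by (simp add: op_power_def)
qed

lemma poly_op_mult: "poly_op (p * q) X = poly_op p X o\<^sub>L poly_op q X"
proof (induction p)
  case 0
  show ?case
    by (simp add: blinfun_eqI)
next
  case (pCons c p)
  have "poly_op (pCons c p * q) X = c *\<^sub>R poly_op q X + (X o\<^sub>L (poly_op p X o\<^sub>L poly_op q X))"
    by (simp add: mult_pCons_left poly_op_add poly_op_smult poly_op_pCons pCons.IH)
  then show ?case
    by (auto intro!: blinfun_eqI simp: poly_op_pCons blinfun.bilinear_simps)
qed

lemma self_adjoint_poly_op:
  assumes "self_adjoint X"
  shows "self_adjoint (poly_op q X)"
proof (induction q)
  case (pCons c q)
  \<comment> \<open>\<open>X\<close> is the value of the polynomial \<open>[:0, 1:]\<close>, so it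
    commutes with \<open>poly_op q X\<close> because polynomials commute.\<close>
  have "X o\<^sub>L poly_op q X = poly_op q X o\<^sub>L X"
    using poly_op_mult [of "[:0, 1:]" q X] poly_op_mult [of q "[:0, 1:]" X]
    by (simp add: poly_op_pCons mult.commute blinfun_compose_zero)
  with pCons assms show ?case
    by (simp add: poly_op_pCons self_adjoint_add self_adjoint_scaleR self_adjoint_id
        self_adjoint_compose_commuting)
qed (simp add: self_adjoint_zero)

section \<open>The real spectrum, and norms of polynomials in an operator\<close>

definition real_spectrum :: "('a::chilbert_space \<Rightarrow>\<^sub>L 'a) \<Rightarrow> real set" where
  "real_spectrum X = {t. complex_of_real t \<in> op_spectrum X}"

lemma real_spectrum_iff: "t \<in> real_spectrum X \<longleftrightarrow> \<not> invertible_op (X - t *\<^sub>R id_blinfun)"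
proof -
  have "scalar_op (complex_of_real t) = t *\<^sub>R (id_blinfun :: 'a \<Rightarrow>\<^sub>L 'a)"
    by (rule blinfun_eqI) (simp add: scaleC_of_real blinfun.bilinear_simps)
  then show ?thesis
    by (simp add: real_spectrum_def op_spectrum_def)
qed

text \<open>For \<open>t < a\<close> the operator \<open>X - t\<close> is coercive, and for
  \<open>b < t\<close> its negative is; either way it is invertible.\<close>

lemma real_spectrum_subset:
  assumes "self_adjoint X"
    and "\<And>x. a * (norm x)\<^sup>2 \<le> rinner (X x) x" "\<And>x. rinner (X x) x \<le> b * (norm x)\<^sup>2"
  shows "real_spectrum X \<subseteq> {a..b}"
proof
  fix t assume t: "t \<in> real_spectrum X"
  have lin: "clinear_op (X - t *\<^sub>R id_blinfun)"
    using self_adjoint_diff [OF assms(1) self_adjoint_scaleR [OF self_adjoint_id, of t]]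
    by (simp add: self_adjoint_iff_rinner)
  have "invertible_op (X - t *\<^sub>R id_blinfun)" if "t < a"
    using that assms(2)
    by (intro coercive_imp_invertible_op [OF lin, of "a - t"])
      (auto simp: blinfun.bilinear_simps rinner.diff_left rinner.scaleR_left rinner_self left_diff_distrib)
  moreover have "invertible_op (X - t *\<^sub>R id_blinfun)" if "b < t"
  proof -
    have "invertible_op ((-1) *\<^sub>R (X - t *\<^sub>R id_blinfun))"
      using that assms(3)
      by (intro coercive_imp_invertible_op [OF clinear_op_scaleR [OF lin], of "t - b"])
        (auto simp: blinfun.bilinear_simps rinner.diff_left rinner.minus_left rinner.scaleR_left rinner_self left_diff_distrib)
    from invertible_op_scaleR [OF this, of "-1"] show ?thesis
      by simp
  qed
  ultimately show "t \<in> {a..b}"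
    using t by (force simp: real_spectrum_iff)
qed

text \<open>There is a complex root \<open>z\<close>. If it is not real, the remainder modulo the
  real quadratic with root \<open>z\<close> has degree below 2 and vanishes at \<open>z\<close>, so
  it is zero.\<close>

lemma real_poly_has_root_or_quadratic_factor:
  fixes q :: "real poly"
  assumes "0 < degree q"
  obtains t where "poly q t = 0"
    | a b d where "b \<noteq> 0" "q = [:a\<^sup>2 + b\<^sup>2, -2 * a, 1:] * d"
proof -
  let ?c = complex_of_real
  have hom: "map_poly ?c (p + p') = map_poly ?c p + map_poly ?c p'"
      "map_poly ?c (p * p') = map_poly ?c p * map_poly ?c p'" for p p'
    by (simp_all add: poly_eq_iff coeff_map_poly coeff_mult)
  have eval: "poly (map_poly ?c p) (?c t) = ?c (poly p t)" for p t
    by (induction p) (simp_all add: map_poly_pCons)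
  have "\<not> constant (poly (map_poly ?c q))"
    using assms by (simp add: constant_degree degree_map_poly)
  then obtain z where z: "poly (map_poly ?c q) z = 0"
    using fundamental_theorem_of_algebra by blast
  show thesis
  proof (cases "Im z = 0")
    case True
    then have "z = ?c (Re z)"
      by (simp add: complex_eq_iff)
    with z have "?c (poly q (Re z)) = 0"
      by (metis eval of_real_0)
    then show thesis
      using that(1) by simp
  next
    case False
    \<comment> \<open>The roots of \<open>h\<close> are \<open>z\<close> and its conjugate.\<close>
    define h where "h = [:(Re z)\<^sup>2 + (Im z)\<^sup>2, -2 * Re z, 1:]"
    define r where "r = q mod h"
    have h: "poly (map_poly ?c h) z = 0"
      by (simp add: h_def map_poly_pCons complex_eq_iff algebra_simps power2_eq_square)
    obtain s where q: "q = h * s + r"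
      using mult_div_mod_eq [of h q] unfolding r_def by metis
    have "h \<noteq> 0" "degree h = 2"
      by (simp_all add: h_def)
    then have deg: "degree r < 2"
      using degree_mod_less [of h q] unfolding r_def by (metis degree_0 zero_less_numeral)
    have "r = [:coeff r 0, coeff r 1:]"
    proof (rule poly_eqI)
      show "coeff r n = coeff [:coeff r 0, coeff r 1:] n" for n
        using deg by (cases n; cases "n - 1") (simp_all add: coeff_eq_0)
    qed
    then obtain r\<^sub>0 r\<^sub>1 where r: "r = [:r\<^sub>0, r\<^sub>1:]"
      by blast
    have "poly (map_poly ?c r) z = 0"
      using z h by (simp add: q hom)
    then have "?c r\<^sub>0 + z * ?c r\<^sub>1 = 0"
      by (simp add: r map_poly_pCons)
    \<comment> \<open>The imaginary part \<open>Im z * r\<^sub>1\<close> vanishes, which forces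
      \<open>r\<^sub>1 = 0\<close>; the real part then gives \<open>r\<^sub>0 = 0\<close>.\<close>
    with False have "r\<^sub>1 = 0" "r\<^sub>0 = 0"
      by (auto simp: complex_eq_iff)
    with r have "r = 0"
      by simp
    with q False show thesis
      using that(2) [of "Im z" "Re z" s] by (simp add: h_def)
  qed
qed

text \<open>Induction on the degree, splitting off one linear or quadratic real factor at a
  time.\<close>

lemma invertible_poly_op:
  fixes X :: "'a::chilbert_space \<Rightarrow>\<^sub>L 'a"
  assumes sa: "self_adjoint X" and "q \<noteq> 0" "\<And>t. t \<in> real_spectrum X \<Longrightarrow> poly q t \<noteq> 0"
  shows "invertible_op (poly_op q X)"
  using assms(2-)
proof (induction "degree q" arbitrary: q rule: less_induct)
  case less
  show ?case
  proof (cases "degree q = 0")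
    case True
    then obtain c where "q = [:c:]"
      by (rule degree_eq_zeroE)
    with less.prems show ?thesis
      by (simp add: poly_op_pCons blinfun_compose_zero invertible_op_scaleR invertible_op_id)
  next
    case False
    then have "0 < degree q"
      by simp
    then show ?thesis
    proof (cases rule: real_poly_has_root_or_quadratic_factor)
      case (1 t)
      then obtain d where d: "q = [:-t, 1:] * d"
        by (auto simp: poly_eq_0_iff_dvd elim: dvdE)
      with less.prems have "d \<noteq> 0"
        by auto
      then have "degree d < degree q"
        unfolding d by (subst degree_mult_eq) auto
      then have "invertible_op (poly_op d X)"
        using less.prems d \<open>d \<noteq> 0\<close> by (intro less.hyps) auto
      moreover have "t \<notin> real_spectrum X"
        using 1 less.prems by auto
      then have "invertible_op (poly_op [:-t, 1:] X)"
        by (simp add: real_spectrum_iff poly_op_pCons blinfun_compose_zero)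
      ultimately show ?thesis
        unfolding d poly_op_mult by (intro invertible_op_compose)
    next
      case (2 a b d)
      with less.prems have "d \<noteq> 0"
        by auto
      then have "degree d < degree q"
        unfolding 2 by (subst degree_mult_eq) auto
      moreover have "poly d t \<noteq> 0" if "t \<in> real_spectrum X" for t
        using less.prems(2) [OF that] unfolding 2 poly_mult by simp
      ultimately have "invertible_op (poly_op d X)"
        using \<open>d \<noteq> 0\<close> by (intro less.hyps)
      moreover have "invertible_op (poly_op [:a\<^sup>2 + b\<^sup>2, -2 * a, 1:] X)"
      proof (rule coercive_imp_invertible_op)
        let ?Z = "poly_op [:-a, 1:] X"
        \<comment> \<open>Completing the square turns the quadratic form into
          \<open>(norm (?Z x))\<^sup>2 + b\<^sup>2 * (norm x)\<^sup>2\<close>.\<close>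
        have sq: "[:a\<^sup>2 + b\<^sup>2, -2 * a, 1:] = [:-a, 1:] * [:-a, 1:] + [:b\<^sup>2:]"
          by (simp add: power2_eq_square)
        show "clinear_op (poly_op [:a\<^sup>2 + b\<^sup>2, -2 * a, 1:] X)"
          using self_adjoint_poly_op [OF sa] by (simp add: self_adjoint_iff_rinner)
        show "b\<^sup>2 * (norm x)\<^sup>2 \<le> rinner (poly_op [:a\<^sup>2 + b\<^sup>2, -2 * a, 1:] X x) x" for x
          unfolding sq poly_op_add poly_op_mult
          using self_adjointD [OF self_adjoint_poly_op [OF sa], of "[:-a, 1:]" "?Z x" x]
          by (simp add: poly_op_pCons [of _ 0] blinfun_compose_zero blinfun.bilinear_simps
              rinner.add_left rinner.scaleR_left rinner_self)
      qed (use 2 in simp)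
      ultimately show ?thesis
        unfolding 2 poly_op_mult by (intro invertible_op_compose)
    qed
  qed
qed

text \<open>Over an empty spectrum even \<open>X\<^sup>2 - (norm X)\<^sup>2\<close> would be
  invertible. The vector \<open>x\<^sub>0\<close> excludes the zero space, where every operator is
  invertible.\<close>

lemma real_spectrum_nonempty:
  fixes X :: "'a::chilbert_space \<Rightarrow>\<^sub>L 'a" and x\<^sub>0 :: 'a
  assumes "self_adjoint X" "x\<^sub>0 \<noteq> 0"
  shows "real_spectrum X \<noteq> {}"
proof
  assume "real_spectrum X = {}"
  then have "invertible_op (poly_op [:-(norm X)\<^sup>2, 0, 1:] X)"
    using assms(1) by (intro invertible_poly_op) auto
  moreover have "poly_op [:-(norm X)\<^sup>2, 0, 1:] X = (X o\<^sub>L X) - (norm X)\<^sup>2 *\<^sub>R id_blinfun"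
    by (simp add: poly_op_pCons blinfun_compose_zero blinfun_eqI blinfun.bilinear_simps)
  ultimately show False
    using square_minus_norm_square_not_invertible [OF assms] by simp
qed

text \<open>If \<open>?m\<close> exceeded \<open>e\<close>, then
  \<open>q * q - [:?m\<^sup>2:]\<close> would have no root in the spectrum, making
  \<open>poly_op q X\<close> squared minus \<open>?m\<^sup>2\<close> invertible.\<close>

lemma norm_poly_op_le:
  fixes X :: "'a::chilbert_space \<Rightarrow>\<^sub>L 'a"
  assumes sa: "self_adjoint X" and "0 \<le> e"
    and e: "\<And>t. t \<in> real_spectrum X \<Longrightarrow> \<bar>poly q t\<bar> \<le> e"
  shows "norm (poly_op q X) \<le> e"
proof (rule ccontr)
  let ?m = "norm (poly_op q X)"
  assume "\<not> ?m \<le> e"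
  then have "e < ?m"
    by simp
  have "\<exists>x\<^sub>0 :: 'a. x\<^sub>0 \<noteq> 0"
  proof (rule ccontr)
    assume "\<nexists>x\<^sub>0 :: 'a. x\<^sub>0 \<noteq> 0"
    then have "?m \<le> 0"
      by (intro norm_blinfun_bound) auto
    with \<open>e < ?m\<close> \<open>0 \<le> e\<close> show False
      by simp
  qed
  then obtain x\<^sub>0 :: 'a where "x\<^sub>0 \<noteq> 0"
    by blast
  have neq: "poly (q * q - [:?m\<^sup>2:]) t \<noteq> 0" if "t \<in> real_spectrum X" for t
  proof -
    have "\<bar>poly q t\<bar>\<^sup>2 < ?m\<^sup>2"
      using e [OF that] \<open>e < ?m\<close> by (intro power_strict_mono) auto
    then show ?thesis
      by (simp add: power2_eq_square)
  qed
  \<comment> \<open>A point of the spectrum is what shows that this polynomial is not zero.\<close>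
  with real_spectrum_nonempty [OF sa \<open>x\<^sub>0 \<noteq> 0\<close>] have "q * q - [:?m\<^sup>2:] \<noteq> 0"
    by (metis ex_in_conv poly_0)
  then have "invertible_op (poly_op (q * q - [:?m\<^sup>2:]) X)"
    using sa neq by (intro invertible_poly_op)
  then show False
    using square_minus_norm_square_not_invertible [OF self_adjoint_poly_op [OF sa] \<open>x\<^sub>0 \<noteq> 0\<close>]
    by (simp add: poly_op_diff poly_op_mult poly_op_pCons blinfun_compose_zero)
qed

section \<open>Functional calculus\<close>

text \<open>Stone-Weierstrass with error \<open>1 / Suc n\<close>, the approximants rewritten as the
  \<open>poly\<close> functions over which \<open>fun_calc\<close> is defined.\<close>

lemma Weierstrass_polynomial_sequence:
  fixes f :: "real \<Rightarrow> real"
  assumes "continuous_on {a..b} f"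
  obtains q where "uniform_limit {a..b} (\<lambda>n. poly (q n)) f sequentially"
proof -
  have "\<exists>q. \<forall>x\<in>{a..b}. \<bar>f x - poly q x\<bar> < 1 / real (Suc n)" for n
  proof -
    obtain g where "real_polynomial_function g"
      and g: "\<And>x. x \<in> {a..b} \<Longrightarrow> \<bar>f x - g x\<bar> < 1 / real (Suc n)"
      using Stone_Weierstrass_real_polynomial_function [OF compact_Icc assms, of "1 / real (Suc n)"]
      by auto
    then obtain c k where "g = (\<lambda>x. \<Sum>i\<le>k. c i * x ^ i)"
      by (auto simp: real_polynomial_function_iff_sum)
    then have "g = poly (\<Sum>i\<le>k. monom (c i) i)"
      by (simp add: fun_eq_iff poly_sum poly_monom)
    with g show ?thesis
      by blast
  qed
  then obtain q where q: "\<And>n x. x \<in> {a..b} \<Longrightarrow> \<bar>f x - poly (q n) x\<bar> < 1 / real (Suc n)"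
    by metis
  have "uniform_limit {a..b} (\<lambda>n. poly (q n)) f sequentially"
  proof (rule uniform_limitI)
    fix e :: real assume "0 < e"
    then have "\<forall>\<^sub>F n in sequentially. 1 / real (Suc n) < e"
      by (intro order_tendstoD [OF lim_inverse_n'[THEN LIMSEQ_Suc]])
    then show "\<forall>\<^sub>F n in sequentially. \<forall>x\<in>{a..b}. dist (poly (q n) x) (f x) < e"
      by eventually_elim (auto simp: dist_real_def abs_minus_commute intro: less_trans q)
  qed
  then show thesis
    by (rule that)
qed

lemma poly_op_limit_exists:
  assumes sa: "self_adjoint X"
    and q: "uniform_limit (real_spectrum X) (\<lambda>n. poly (q n)) f sequentially"
  shows "convergent (\<lambda>n. poly_op (q n) X)"
proof -
  have "Cauchy (\<lambda>n. poly_op (q n) X)"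
    unfolding Cauchy_def
  proof (intro allI impI)
    fix e :: real assume "0 < e"
    \<comment> \<open>Two errors below \<open>e / 4\<close> give a norm of at most
      \<open>e / 2\<close>. The slack is there because \<open>norm_poly_op_le\<close> is not
      strict.\<close>
    then obtain N where N: "\<And>n t. n \<ge> N \<Longrightarrow> t \<in> real_spectrum X \<Longrightarrow> dist (poly (q n) t) (f t) < e / 4"
      using q unfolding uniform_limit_sequentially_iff by (meson zero_less_divide_iff zero_less_numeral)
    have "dist (poly_op (q m) X) (poly_op (q n) X) < e" if "m \<ge> N" "n \<ge> N" for m n
    proof -
      have "norm (poly_op (q m - q n) X) \<le> e / 2"
      proof (rule norm_poly_op_le [OF sa])
        show "\<bar>poly (q m - q n) t\<bar> \<le> e / 2" if "t \<in> real_spectrum X" for t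
          using N [OF \<open>m \<ge> N\<close> that] N [OF \<open>n \<ge> N\<close> that] unfolding dist_real_def poly_diff by linarith
      qed (use \<open>0 < e\<close> in simp)
      then show ?thesis
        using \<open>0 < e\<close> by (simp add: dist_norm poly_op_diff)
    qed
    then show "\<exists>M. \<forall>m\<ge>M. \<forall>n\<ge>M. dist (poly_op (q m) X) (poly_op (q n) X) < e"
      by blast
  qed
  then show ?thesis
    by (rule Cauchy_convergent)
qed

text \<open>Makes the limit independent of the approximating sequence, as the definite description
  in \<open>fun_calc\<close> demands.\<close>

lemma poly_op_diff_tendsto_0:
  assumes sa: "self_adjoint X"
    and q: "uniform_limit (real_spectrum X) (\<lambda>n. poly (q n)) f sequentially"
    and r: "uniform_limit (real_spectrum X) (\<lambda>n. poly (r n)) f sequentially"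
  shows "(\<lambda>n. poly_op (q n) X - poly_op (r n) X) \<longlonglongrightarrow> 0"
proof (rule tendstoI)
  fix e :: real assume "0 < e"
  then have "0 < e / 4"
    by simp
  from uniform_limitD [OF q this] uniform_limitD [OF r this]
  show "\<forall>\<^sub>F n in sequentially. dist (poly_op (q n) X - poly_op (r n) X) 0 < e"
  proof eventually_elim
    case (elim n)
    have "norm (poly_op (q n - r n) X) \<le> e / 2"
    proof (rule norm_poly_op_le [OF sa])
      show "\<bar>poly (q n - r n) t\<bar> \<le> e / 2" if "t \<in> real_spectrum X" for t
        using elim(1) [rule_format, OF that] elim(2) [rule_format, OF that]
        unfolding dist_real_def poly_diff by linarith
    qed (use \<open>0 < e\<close> in simp)
    then show ?case
      using \<open>0 < e\<close> by (simp add: poly_op_diff)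
  qed
qed

text \<open>
  The functional calculus is only needed for functions continuous on an interval around the
  spectrum, so that compactness of the spectrum plays no role.
\<close>

locale spectral_bounds =
  fixes X :: "'a::chilbert_space \<Rightarrow>\<^sub>L 'a" and a b :: real
  assumes sa: "self_adjoint X"
    and spectrum: "real_spectrum X \<subseteq> {a..b}"
begin

lemma fun_calc_tendsto:
  assumes cont: "continuous_on {a..b} f"
    and q: "uniform_limit {a..b} (\<lambda>n. poly (q n)) f sequentially"
  shows "(\<lambda>n. poly_op (q n) X) \<longlonglongrightarrow> fun_calc f X"
proof -
  have q': "uniform_limit (real_spectrum X) (\<lambda>n. poly (q n)) f sequentially"
    using q spectrum by (rule uniform_limit_on_subset)
  obtain Y where Y: "(\<lambda>n. poly_op (q n) X) \<longlonglongrightarrow> Y"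
    using poly_op_limit_exists [OF sa q'] by (auto simp: convergent_def)
  have "fun_calc f X = Y"
    \<comment> \<open>The limit along \<open>q\<close> is inherited by every other sequence
      \<open>r\<close>. It is unique because \<open>q\<close> itself is admissible.\<close>
    unfolding fun_calc_def real_spectrum_def [symmetric]
  proof (rule the_equality)
    show "\<forall>r. uniform_limit (real_spectrum X) (\<lambda>n. poly (r n)) f sequentially \<longrightarrow>
        (\<lambda>n. poly_op (r n) X) \<longlonglongrightarrow> Y"
    proof safe
      fix r assume r: "uniform_limit (real_spectrum X) (\<lambda>n. poly (r n)) f sequentially"
      show "(\<lambda>n. poly_op (r n) X) \<longlonglongrightarrow> Y"
        using tendsto_add [OF poly_op_diff_tendsto_0 [OF sa r q'] Y] by simp
    qed
  next
    fix Z assume "\<forall>r. uniform_limit (real_spectrum X) (\<lambda>n. poly (r n)) f sequentially \<longrightarrow>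
        (\<lambda>n. poly_op (r n) X) \<longlonglongrightarrow> Z"
    with q' Y show "Z = Y"
      by (blast intro: LIMSEQ_unique)
  qed
  with Y show ?thesis
    by simp
qed

lemma fun_calc_poly: "fun_calc (poly q) X = poly_op q X"
proof -
  have "(\<lambda>n. poly_op q X) \<longlonglongrightarrow> fun_calc (poly q) X"
    by (rule fun_calc_tendsto) (auto intro: continuous_intros uniform_limit_const)
  then show ?thesis
    by (simp add: LIMSEQ_const_iff)
qed

lemma fun_calc_const: "fun_calc (\<lambda>t. c) X = c *\<^sub>R id_blinfun"
  using fun_calc_poly [of "[:c:]"] by (simp add: poly_op_pCons [abs_def] poly_pCons [abs_def])

lemma fun_calc_ident: "fun_calc (\<lambda>t. t) X = X"
  using fun_calc_poly [of "[:0, 1:]"] by (simp add: poly_op_pCons poly_pCons [abs_def])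

text \<open>Only the values on the spectrum enter the definition of \<open>fun_calc\<close>.\<close>

lemma fun_calc_cong:
  assumes "\<And>t. t \<in> {a..b} \<Longrightarrow> f t = g t"
  shows "fun_calc f X = fun_calc g X"
proof -
  have "uniform_limit (real_spectrum X) h f sequentially \<longleftrightarrow>
      uniform_limit (real_spectrum X) h g sequentially" for h
    using assms spectrum by (intro uniform_limit_cong') auto
  then show ?thesis
    by (simp add: fun_calc_def flip: real_spectrum_def)
qed

lemma fun_calc_add:
  assumes "continuous_on {a..b} f" "continuous_on {a..b} g"
  shows "fun_calc (\<lambda>t. f t + g t) X = fun_calc f X + fun_calc g X"
proof -
  obtain q r where
    q: "uniform_limit {a..b} (\<lambda>n. poly (q n)) f sequentially" and
    r: "uniform_limit {a..b} (\<lambda>n. poly (r n)) g sequentially"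
    using assms by (metis Weierstrass_polynomial_sequence)
  have "uniform_limit {a..b} (\<lambda>n. poly (q n + r n)) (\<lambda>t. f t + g t) sequentially"
    using uniform_limit_add [OF q r] by (simp add: poly_add [abs_def])
  with assms have "(\<lambda>n. poly_op (q n + r n) X) \<longlonglongrightarrow> fun_calc (\<lambda>t. f t + g t) X"
    by (intro fun_calc_tendsto continuous_intros)
  moreover have "(\<lambda>n. poly_op (q n + r n) X) \<longlonglongrightarrow> fun_calc f X + fun_calc g X"
    unfolding poly_op_add using assms q r by (intro tendsto_add fun_calc_tendsto)
  ultimately show ?thesis
    by (rule LIMSEQ_unique)
qed

lemma fun_calc_mult:
  assumes "continuous_on {a..b} f" "continuous_on {a..b} g"
  shows "fun_calc (\<lambda>t. f t * g t) X = fun_calc f X o\<^sub>L fun_calc g X"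
proof -
  obtain q r where
    q: "uniform_limit {a..b} (\<lambda>n. poly (q n)) f sequentially" and
    r: "uniform_limit {a..b} (\<lambda>n. poly (r n)) g sequentially"
    using assms by (metis Weierstrass_polynomial_sequence)
  \<comment> \<open>Products of uniform limits converge uniformly when the limits are bounded, which
    compactness of the interval provides.\<close>
  have "bounded (f ` {a..b})" "bounded (g ` {a..b})"
    using assms by (auto intro!: compact_imp_bounded compact_continuous_image)
  then have "uniform_limit {a..b} (\<lambda>n. poly (q n * r n)) (\<lambda>t. f t * g t) sequentially"
    using uniform_lim_mult [OF q r] by (simp add: poly_mult [abs_def])
  with assms have "(\<lambda>n. poly_op (q n * r n) X) \<longlonglongrightarrow> fun_calc (\<lambda>t. f t * g t) X"
    by (intro fun_calc_tendsto continuous_intros)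
  moreover have "(\<lambda>n. poly_op (q n * r n) X) \<longlonglongrightarrow> (fun_calc f X o\<^sub>L fun_calc g X)"
    unfolding poly_op_mult using assms q r
    by (intro bounded_bilinear.tendsto [OF bounded_bilinear_blinfun_compose] fun_calc_tendsto)
  ultimately show ?thesis
    by (rule LIMSEQ_unique)
qed

lemma fun_calc_scale:
  assumes "continuous_on {a..b} f"
  shows "fun_calc (\<lambda>t. c * f t) X = c *\<^sub>R fun_calc f X"
  using fun_calc_mult [OF continuous_on_const assms, of c]
  by (simp add: fun_calc_const bounded_bilinear.scaleR_left [OF bounded_bilinear_blinfun_compose])

lemma fun_calc_diff:
  assumes "continuous_on {a..b} f" "continuous_on {a..b} g"
  shows "fun_calc (\<lambda>t. f t - g t) X = fun_calc f X - fun_calc g X"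
  using fun_calc_add [of f "\<lambda>t. -1 * g t"] fun_calc_scale [of g "-1"] assms
  by (simp add: continuous_on_minus)

text \<open>Complex linearity and symmetry pass from the approximating polynomials to their
  pointwise limit.\<close>

lemma self_adjoint_fun_calc:
  assumes "continuous_on {a..b} f"
  shows "self_adjoint (fun_calc f X)"
proof -
  obtain q where q: "uniform_limit {a..b} (\<lambda>n. poly (q n)) f sequentially"
    using assms by (rule Weierstrass_polynomial_sequence)
  have lim: "(\<lambda>n. poly_op (q n) X x) \<longlonglongrightarrow> fun_calc f X x" for x
    using fun_calc_tendsto [OF assms q] by (intro blinfun.tendsto tendsto_const)
  have sym: "self_adjoint (poly_op (q n) X)" for n
    by (rule self_adjoint_poly_op [OF sa])
  have "clinear_op (fun_calc f X)"
    unfolding clinear_op_def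
  proof safe
    fix c x
    \<comment> \<open>Continuity of the complex scaling comes from the bounded operator
      \<open>scalar_op c\<close>.\<close>
    have "(\<lambda>n. c *\<^sub>C poly_op (q n) X x) \<longlonglongrightarrow> c *\<^sub>C fun_calc f X x"
      using blinfun.tendsto [OF tendsto_const lim, of "scalar_op c"] by simp
    moreover have "c *\<^sub>C poly_op (q n) X x = poly_op (q n) X (c *\<^sub>C x)" for n
      using sym by (simp add: self_adjoint_def clinear_op_def)
    ultimately show "fun_calc f X (c *\<^sub>C x) = c *\<^sub>C fun_calc f X x"
      using lim [of "c *\<^sub>C x"] by (auto intro: LIMSEQ_unique)
  qed
  moreover have "rinner (fun_calc f X x) y = rinner x (fun_calc f X y)" for x y
  proof (rule LIMSEQ_unique)
    show "(\<lambda>n. rinner (poly_op (q n) X x) y) \<longlonglongrightarrow> rinner (fun_calc f X x) y"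
      by (intro rinner.tendsto lim tendsto_const)
    show "(\<lambda>n. rinner (poly_op (q n) X x) y) \<longlonglongrightarrow> rinner x (fun_calc f X y)"
      unfolding self_adjointD [OF sym] by (intro rinner.tendsto lim tendsto_const)
  qed
  ultimately show ?thesis
    by (simp add: self_adjoint_iff_rinner)
qed

text \<open>The difference is the square of the self-adjoint operator \<open>fun_calc ?h X\<close>,
  so its quadratic form is a squared norm.\<close>

lemma fun_calc_mono:
  assumes "continuous_on {a..b} f" "continuous_on {a..b} g" "\<And>t. t \<in> {a..b} \<Longrightarrow> f t \<le> g t"
  shows "fun_calc f X \<preceq> fun_calc g X"
proof -
  let ?h = "\<lambda>t. sqrt (g t - f t)"
  have h: "continuous_on {a..b} ?h"
    using assms by (intro continuous_intros)
  have "fun_calc g X - fun_calc f X = fun_calc (\<lambda>t. ?h t * ?h t) X"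
    unfolding fun_calc_diff [OF assms(2,1), symmetric] using assms(3) by (intro fun_calc_cong) simp
  also have "\<dots> = fun_calc ?h X o\<^sub>L fun_calc ?h X"
    by (rule fun_calc_mult [OF h h])
  finally have "rinner ((fun_calc g X - fun_calc f X) x) x = (norm (fun_calc ?h X x))\<^sup>2" for x
    using self_adjointD [OF self_adjoint_fun_calc [OF h], of "fun_calc ?h X x" x]
    by (simp add: rinner_self)
  then show ?thesis
    using assms(1,2)
    by (auto simp: loewner_le_def positive_op_iff_rinner intro: self_adjoint_diff self_adjoint_fun_calc)
qed

end

section \<open>Tsallis relative operator entropy\<close>

text \<open>Invertibility bounds \<open>norm x\<close> by \<open>K * norm (A x)\<close>, and
  positivity bounds \<open>(norm (A x))\<^sup>2\<close> by \<open>M * rinner (A x) x\<close>.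
  Together they give the constant \<open>1 / (K\<^sup>2 * M)\<close>.\<close>

lemma strictly_positive_coercive:
  assumes "strictly_positive A"
  obtains a where "0 < a" "\<And>x. a * (norm x)\<^sup>2 \<le> rinner (blinfun_apply A x) x"
proof -
  have sa: "self_adjoint A" and pos: "0 \<le> rinner (A x) x" and inv: "invertible_op A" for x
    using assms by (auto simp: strictly_positive_def positive_op_iff_rinner)
  obtain K where "0 < K" and K: "\<And>x. norm x \<le> K * norm (A x)"
    using inv by (rule invertible_op_bounded_below) blast
  define M where "M = norm A + 1"
  have "0 < M"
    by (simp add: M_def add_nonneg_pos)
  have bound: "rinner (A y) y \<le> M * (norm y)\<^sup>2" for y
  proof -
    have "rinner (A y) y \<le> norm (A y) * norm y"
      by (rule rinner_le_norm)
    also have "\<dots> \<le> norm A * norm y * norm y"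
      by (intro mult_right_mono norm_blinfun) auto
    also have "\<dots> \<le> M * (norm y)\<^sup>2"
      by (simp add: M_def power2_eq_square distrib_right)
    finally show ?thesis .
  qed
  \<comment> \<open>Cauchy--Schwarz for the form \<open>\<langle>A x, y\<rangle>\<close>, in the shape of its positivity at \<open>x - (1/M) A x\<close>.\<close>
  have *: "(norm (A x))\<^sup>2 \<le> M * rinner (A x) x" for x
  proof -
    let ?y = "x - (1 / M) *\<^sub>R A x"
    have "0 \<le> rinner (A ?y) ?y"
      by (rule pos)
    also have "\<dots> = rinner (A x) x - 2 / M * (norm (A x))\<^sup>2 + rinner (A (A x)) (A x) / M\<^sup>2"
      by (simp add: blinfun.bilinear_simps rinner.diff_left rinner.diff_right rinner.scaleR_left
          rinner.scaleR_right self_adjointD [OF sa, of "A x" x] rinner_self power2_eq_square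
          diff_divide_distrib)
    also have "\<dots> \<le> rinner (A x) x - 2 / M * (norm (A x))\<^sup>2 + M * (norm (A x))\<^sup>2 / M\<^sup>2"
      using bound [of "A x"] by (intro add_left_mono divide_right_mono) auto
    also have "\<dots> = rinner (A x) x - (norm (A x))\<^sup>2 / M"
      using \<open>0 < M\<close> by (simp add: field_simps power2_eq_square)
    finally show ?thesis
      using \<open>0 < M\<close> by (simp add: field_simps)
  qed
  show thesis
  proof
    show "0 < 1 / (K\<^sup>2 * M)"
      using \<open>0 < K\<close> \<open>0 < M\<close> by simp
    show "1 / (K\<^sup>2 * M) * (norm x)\<^sup>2 \<le> rinner (A x) x" for x
    proof -
      have "(norm x)\<^sup>2 \<le> (K * norm (A x))\<^sup>2"
        by (intro power_mono K) auto
      also have "\<dots> \<le> K\<^sup>2 * (M * rinner (A x) x)"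
        unfolding power_mult_distrib by (intro mult_left_mono *) auto
      finally show ?thesis
        using \<open>0 < K\<close> \<open>0 < M\<close> by (simp add: field_simps)
    qed
  qed
qed

text \<open>A positive lower end keeps the interval away from 0, so that all real powers are
  continuous on it.\<close>

lemma strictly_positive_spectral_bounds:
  assumes "strictly_positive A"
  obtains a b where "0 < a" "spectral_bounds A a b"
proof -
  obtain a where a: "0 < a" "\<And>x. a * (norm x)\<^sup>2 \<le> rinner (A x) x"
    using assms by (rule strictly_positive_coercive) blast
  have sa: "self_adjoint A"
    using assms by (simp add: strictly_positive_def positive_op_def)
  have "rinner (A x) x \<le> norm A * (norm x)\<^sup>2" for x
    using rinner_le_norm [of "A x" x] mult_right_mono [OF norm_blinfun [of A x] norm_ge_zero [of x]]
    by (simp add: power2_eq_square mult.assoc)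
  then have "spectral_bounds A a (norm A)"
    using a(2) sa by (intro spectral_bounds.intro real_spectrum_subset)
  with a(1) show thesis
    by (rule that)
qed

section \<open>Scalar inequalities for hyperbolic functions, powers and logarithms\<close>

lemma sinh_ge_self:
  fixes s :: real
  assumes "0 \<le> s"
  shows "s \<le> sinh s"
proof -
  have "sinh 0 - 0 \<le> sinh s - s"
  proof (rule DERIV_nonneg_imp_nondecreasing [OF assms])
    show "\<exists>y. ((\<lambda>s. sinh s - s) has_real_derivative y) (at x) \<and> 0 \<le> y" for x :: real
      using cosh_real_ge_1 [of x] by (intro exI [of _ "cosh x - 1"]) (auto intro!: derivative_eq_intros)
  qed
  then show ?thesis
    by simp
qed

lemma sinh_le_self_times_cosh:
  fixes s :: real
  assumes "0 \<le> s"
  shows "sinh s \<le> s * cosh s"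
proof -
  have "0 * cosh 0 - sinh 0 \<le> s * cosh s - sinh s"
  proof (rule DERIV_nonneg_imp_nondecreasing [OF assms])
    show "\<exists>y. ((\<lambda>s. s * cosh s - sinh s) has_real_derivative y) (at x) \<and> 0 \<le> y" if "0 \<le> x" for x :: real
      using that by (intro exI [of _ "x * sinh x"]) (auto intro!: derivative_eq_intros)
  qed
  then show ?thesis
    by simp
qed

text \<open>With \<open>s = p/2 * ln t\<close>, the bounds read \<open>s \<le> sinh s \<le> s cosh s\<close>, up to the factor \<open>2 exp s / p\<close>.\<close>

lemma tsallis_scalar_diffs:
  fixes t p :: real
  assumes "0 < t" "p \<noteq> 0"
  defines "s \<equiv> p / 2 * ln t"
  shows "(t powr p - 1) / p - t powr (p/2) * ln t = 2 * exp s * ((sinh s - s) / p)"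
    and "(ln t + t powr p * ln t) / 2 - (t powr p - 1) / p = 2 * exp s * ((s * cosh s - sinh s) / p)"
proof -
  have powr: "t powr (p/2) = exp s" "t powr p = exp s * exp s"
    using \<open>0 < t\<close> by (auto simp: powr_def s_def simp flip: exp_add)
  have ln: "ln t = 2 * s / p"
    using \<open>p \<noteq> 0\<close> by (simp add: s_def)
  have hyp: "sinh s = (exp s - 1 / exp s) / 2" "cosh s = (exp s + 1 / exp s) / 2"
    by (simp_all add: sinh_def cosh_def exp_minus field_simps)
  show "(t powr p - 1) / p - t powr (p/2) * ln t = 2 * exp s * ((sinh s - s) / p)"
    and "(ln t + t powr p * ln t) / 2 - (t powr p - 1) / p = 2 * exp s * ((s * cosh s - sinh s) / p)"
    unfolding powr ln hyp using \<open>p \<noteq> 0\<close> by (simp_all add: field_simps)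
qed

text \<open>For \<open>1 \<le> t\<close> the number \<open>s\<close> is zero or has the sign of
  \<open>p\<close>. Both numerators are odd in \<open>s\<close>, so their quotients by
  \<open>p\<close> are nonnegative.\<close>

lemma tsallis_scalar_ge_1:
  fixes t p :: real
  assumes "1 \<le> t" "p \<noteq> 0"
  shows "t powr (p/2) * ln t \<le> (t powr p - 1) / p"
    and "(t powr p - 1) / p \<le> (ln t + t powr p * ln t) / 2"
proof -
  define s where "s = p / 2 * ln t"
  have "0 \<le> (sinh s - s) / p \<and> 0 \<le> (s * cosh s - sinh s) / p"
  proof (cases "0 < p")
    case True
    with assms(1) have "0 \<le> s"
      by (simp add: s_def)
    with True show ?thesis
      using sinh_ge_self sinh_le_self_times_cosh by simp
  next
    case False
    with assms have "p < 0" "0 \<le> - s"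
      by (auto simp: s_def mult_nonpos_nonneg)
    with sinh_ge_self [of "- s"] sinh_le_self_times_cosh [of "- s"] show ?thesis
      by (simp add: zero_le_divide_iff)
  qed
  then have "0 \<le> 2 * exp s * ((sinh s - s) / p)" "0 \<le> 2 * exp s * ((s * cosh s - sinh s) / p)"
    by (auto intro!: mult_nonneg_nonneg simp del: times_divide_eq_right)
  with tsallis_scalar_diffs [of t p, folded s_def] assms
  show "t powr (p/2) * ln t \<le> (t powr p - 1) / p"
    and "(t powr p - 1) / p \<le> (ln t + t powr p * ln t) / 2"
    by linarith+
qed

text \<open>For \<open>t \<le> 1\<close> the number \<open>s\<close> is zero or has the sign
  opposite to \<open>p\<close>, which reverses both inequalities.\<close>

lemma tsallis_scalar_le_1:
  fixes t p :: real
  assumes "0 < t" "t \<le> 1" "p \<noteq> 0"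
  shows "(t powr p - 1) / p \<le> t powr (p/2) * ln t"
    and "(ln t + t powr p * ln t) / 2 \<le> (t powr p - 1) / p"
proof -
  define s where "s = p / 2 * ln t"
  have "(sinh s - s) / p \<le> 0 \<and> (s * cosh s - sinh s) / p \<le> 0"
  proof (cases "0 < p")
    case True
    with assms have "0 \<le> - s"
      by (simp add: s_def mult_nonneg_nonpos)
    with True sinh_ge_self [of "- s"] sinh_le_self_times_cosh [of "- s"] show ?thesis
      by (simp add: divide_le_0_iff)
  next
    case False
    with assms have "p < 0" "0 \<le> s"
      by (auto simp: s_def mult_nonpos_nonpos)
    with sinh_ge_self [of s] sinh_le_self_times_cosh [of s] show ?thesis
      by (simp add: divide_le_0_iff)
  qed
  then have "2 * exp s * ((sinh s - s) / p) \<le> 0" "2 * exp s * ((s * cosh s - sinh s) / p) \<le> 0"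
    by (auto intro!: mult_nonneg_nonpos simp del: times_divide_eq_right)
  with tsallis_scalar_diffs [of t p, folded s_def] assms
  show "(t powr p - 1) / p \<le> t powr (p/2) * ln t"
    and "(ln t + t powr p * ln t) / 2 \<le> (t powr p - 1) / p"
    by linarith+
qed

section \<open>Reduction of the operator inequalities to the scalar ones\<close>

theorem theorem2p3:
  fixes A B :: "'a::chilbert_space \<Rightarrow>\<^sub>L 'a" and u v p :: real
  assumes "strictly_positive A" and "strictly_positive B"
    and "0 < u" and "0 < v"
    and "u *\<^sub>R A \<preceq> B" and "B \<preceq> v *\<^sub>R A"
    and "-1 \<le> p" and "p \<le> 1" and "p \<noteq> 0"
  shows "(1 \<le> u \<longrightarrow>
            gen_rel_entropy (p/2) A B \<preceq> tsallis_rel_entropy p A B \<and>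
            tsallis_rel_entropy p A B \<preceq> (rel_entropy A B + gen_rel_entropy p A B) /\<^sub>R 2)
       \<and> (v \<le> 1 \<longrightarrow>
            tsallis_rel_entropy p A B \<preceq> gen_rel_entropy (p/2) A B \<and>
            (rel_entropy A B + gen_rel_entropy p A B) /\<^sub>R 2 \<preceq> tsallis_rel_entropy p A B)"
proof -
  obtain a b where "0 < a" and bounds: "spectral_bounds A a b"
    using assms(1) by (rule strictly_positive_spectral_bounds)
  interpret A: spectral_bounds A a b
    by (rule bounds)
  have powr_cont: "continuous_on {c..d} (\<lambda>t::real. t powr r)" if "0 < c" for c d r
    using that by (intro continuous_intros) auto
  have ln_cont: "continuous_on {c..d} (ln :: real \<Rightarrow> real)" if "0 < c" for c d
    using that by (intro continuous_intros) auto
  define R Q X where "R = op_powr A (1/2)" and "Q = op_powr A (-1/2)" and "X = rel_quot A B"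
  have R_sa: "self_adjoint R" and Q_sa: "self_adjoint Q"
    unfolding R_def Q_def op_powr_def using \<open>0 < a\<close>
    by (auto intro!: A.self_adjoint_fun_calc powr_cont)
  have RR: "R o\<^sub>L R = A"
  proof -
    have "R o\<^sub>L R = fun_calc (\<lambda>t. t powr (1/2) * t powr (1/2)) A"
      unfolding R_def op_powr_def using \<open>0 < a\<close> by (intro A.fun_calc_mult [symmetric] powr_cont)
    also have "\<dots> = fun_calc (\<lambda>t. t) A"
      using \<open>0 < a\<close> by (intro A.fun_calc_cong) (simp flip: powr_add)
    finally show ?thesis
      by (simp add: A.fun_calc_ident)
  qed
  \<comment> \<open>This identity makes the quadratic form of \<open>A\<close> at \<open>Q x\<close>
    equal to \<open>(norm x)\<^sup>2\<close>.\<close>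
  have QAQ: "Q o\<^sub>L A o\<^sub>L Q = id_blinfun"
  proof -
    let ?f = "\<lambda>t::real. t powr (-1/2)"
    have f: "continuous_on {a..b} ?f" "continuous_on {a..b} (\<lambda>t. ?f t * t)"
      using \<open>0 < a\<close> by (auto intro!: continuous_intros)
    have "Q o\<^sub>L A o\<^sub>L Q = fun_calc (\<lambda>t. ?f t * t * ?f t) A"
      unfolding A.fun_calc_mult [OF f(2,1)] A.fun_calc_mult [OF f(1) continuous_on_id]
      by (simp add: Q_def op_powr_def A.fun_calc_ident)
    also have "\<dots> = fun_calc (\<lambda>t. 1) A"
    proof (rule A.fun_calc_cong)
      fix t assume "t \<in> {a..b}"
      with \<open>0 < a\<close> have "0 < t"
        by simp
      have "?f t * t * ?f t = t powr (-1/2) * t powr 1 * t powr (-1/2)"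
        using \<open>0 < t\<close> by simp
      also have "\<dots> = 1"
        unfolding powr_add [symmetric] using \<open>0 < t\<close> by simp
      finally show "?f t * t * ?f t = 1" .
    qed
    finally show ?thesis
      by (simp add: A.fun_calc_const)
  qed
  have B_sa: "self_adjoint B"
    using assms(2) by (simp add: strictly_positive_def positive_op_def)
  have X: "X = Q o\<^sub>L B o\<^sub>L Q"
    by (simp add: X_def rel_quot_def Q_def)
  have X_form: "rinner (X x) x = rinner (B (Q x)) (Q x)" for x
    by (simp add: X self_adjointD [OF Q_sa])
  have A_form: "rinner (A (Q x)) (Q x) = (norm x)\<^sup>2" for x
  proof -
    have "Q (A (Q x)) = x"
      using arg_cong [OF QAQ, of "\<lambda>Z. blinfun_apply Z x"] by simp
    then show ?thesis
      using self_adjointD [OF Q_sa, of "A (Q x)" x] by (simp add: rinner_self)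
  qed
  have "u * rinner (A y) y \<le> rinner (B y) y" "rinner (B y) y \<le> v * rinner (A y) y" for y
    using assms(5,6) by (auto simp: loewner_le_def positive_op_iff_rinner blinfun.bilinear_simps
        rinner.diff_left rinner.scaleR_left)
  \<comment> \<open>The bounds on \<open>B\<close> are taken at \<open>y = Q x\<close>.\<close>
  then have form: "u * (norm x)\<^sup>2 \<le> rinner (X x) x" "rinner (X x) x \<le> v * (norm x)\<^sup>2" for x
    by (simp_all add: X_form flip: A_form)
  have "self_adjoint X"
    unfolding X using Q_sa B_sa by (rule self_adjoint_conjugate)
  with form interpret X: spectral_bounds X u v
    by (intro spectral_bounds.intro real_spectrum_subset)
  \<comment> \<open>Each entropy will be \<open>\<Phi>\<close> of a scalar function, and
    \<open>\<Phi>\<close> is monotone because the calculus and conjugation by \<open>R\<close> both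
    are.\<close>
  define \<Phi> where "\<Phi> f = R o\<^sub>L fun_calc f X o\<^sub>L R" for f
  note cont = powr_cont [OF \<open>0 < u\<close>] ln_cont [OF \<open>0 < u\<close>]
  have gen: "gen_rel_entropy r A B = \<Phi> (\<lambda>t. t powr r * ln t)" for r
  proof -
    have "op_powr X r o\<^sub>L op_log X = fun_calc (\<lambda>t. t powr r * ln t) X"
      unfolding op_powr_def op_log_def by (intro X.fun_calc_mult [symmetric] cont)
    then have "fun_calc (\<lambda>t. t powr r * ln t) X y = op_powr X r (op_log X y)" for y
      by (metis blinfun_apply_blinfun_compose)
    then show ?thesis
      unfolding gen_rel_entropy_def \<Phi>_def X_def [symmetric] R_def [symmetric]
      by (intro blinfun_eqI) simp
  qed
  have tsallis: "tsallis_rel_entropy p A B = \<Phi> (\<lambda>t. (t powr p - 1) / p)"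
  proof -
    have "fun_calc (\<lambda>t. (t powr p - 1) / p) X = inverse p *\<^sub>R (op_powr X p - id_blinfun)"
      using X.fun_calc_scale [of "\<lambda>t. t powr p - 1" "inverse p"]
        X.fun_calc_diff [of "\<lambda>t. t powr p" "\<lambda>_. 1"]
      by (simp add: cont continuous_on_diff X.fun_calc_const op_powr_def divide_inverse mult.commute)
    \<comment> \<open>The subtracted \<open>A\<close> is rewritten as \<open>R o\<^sub>L R\<close>,
      which is \<open>\<Phi>\<close> of the constant 1.\<close>
    then show ?thesis
      unfolding tsallis_rel_entropy_def \<Phi>_def X_def [symmetric] R_def [symmetric]
        RR [symmetric, THEN arg_cong [where f = "\<lambda>Z. (_ - Z) /\<^sub>R p"]]
      by (intro blinfun_eqI) (simp add: blinfun.bilinear_simps)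
  qed
  have mean: "(rel_entropy A B + gen_rel_entropy p A B) /\<^sub>R 2
      = \<Phi> (\<lambda>t. (ln t + t powr p * ln t) / 2)"
  proof -
    have c: "continuous_on {u..v} (\<lambda>t. t powr p * ln t)"
        "continuous_on {u..v} (\<lambda>t. ln t + t powr p * ln t)"
      by (intro continuous_on_add continuous_on_mult cont)+
    have "fun_calc (\<lambda>t. (ln t + t powr p * ln t) / 2) X
        = fun_calc (\<lambda>t. inverse 2 * (ln t + t powr p * ln t)) X"
      by (intro X.fun_calc_cong) simp
    then have "fun_calc (\<lambda>t. (ln t + t powr p * ln t) / 2) X
        = inverse 2 *\<^sub>R (op_log X + fun_calc (\<lambda>t. t powr p * ln t) X)"
      unfolding X.fun_calc_scale [OF c(2)] X.fun_calc_add [OF cont(2) c(1)] op_log_def .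
    then show ?thesis
      unfolding gen rel_entropy_def \<Phi>_def X_def [symmetric] R_def [symmetric]
      by (intro blinfun_eqI) (simp add: blinfun.bilinear_simps scaleR_add_right)
  qed
  have \<Phi>_mono: "\<Phi> f \<preceq> \<Phi> g"
    if "continuous_on {u..v} f" "continuous_on {u..v} g" "\<And>t. t \<in> {u..v} \<Longrightarrow> f t \<le> g t" for f g
    unfolding \<Phi>_def using that by (intro loewner_le_conjugate R_sa X.fun_calc_mono)
  have cont': "continuous_on {u..v} (\<lambda>t. t powr (p/2) * ln t)"
      "continuous_on {u..v} (\<lambda>t. (t powr p - 1) / p)"
      "continuous_on {u..v} (\<lambda>t. (ln t + t powr p * ln t) / 2)"
    using \<open>0 < u\<close> \<open>p \<noteq> 0\<close> by (auto intro!: continuous_intros)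
  \<comment> \<open>On \<open>{u..v}\<close> the assumption \<open>1 \<le> u\<close> gives
    \<open>1 \<le> t\<close>, while \<open>v \<le> 1\<close> gives \<open>t \<le> 1\<close> and
    \<open>0 < u\<close> gives \<open>0 < t\<close>.\<close>
  show ?thesis
    unfolding gen [of "p/2"] tsallis mean using \<open>0 < u\<close> \<open>p \<noteq> 0\<close>
    by (auto intro!: \<Phi>_mono cont' tsallis_scalar_ge_1 tsallis_scalar_le_1)
qed

end
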